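(* Fix a total degree $n \in \mathbf{N}$, $n \ge 1$. For $P, Q \in \mathbf{N}$ let $\{\varphi_j\}_{j=1}^N$ be the tensor-product basis of the space of polynomials of total degree at most $n$ in $P$ variables on $\varTheta = E^P$, let $\boldsymbol{V} \in \mathbf{R}^{Q \times N}$ be a given (precomputed) matrix, and let $\boldsymbol{U} \colon \varTheta \to \mathbf{R}^Q$, $\boldsymbol{U}(\boldsymbol{\vartheta}) = \boldsymbol{V} \boldsymbol{\varphi}(\boldsymbol{\vartheta})$, where $\boldsymbol{\varphi} = (\varphi_1, \ldots, \varphi_N)^{\mathrm{T}}$. Then, given $\boldsymbol{\vartheta} \in \varTheta$, the vector $\boldsymbol{U}(\boldsymbol{\vartheta}) \in \mathbf{R}^Q$ and all first-order partial derivatives of $\boldsymbol{U}$ at $\boldsymbol{\vartheta}$, i.e. the full Jacobian matrix $\boldsymbol{J}_{\boldsymbol{U}}(\boldsymbol{\vartheta}) \in \mathbf{R}^{Q \times P}$, can be computed with $\mathcal{O}(P^n Q)$ arithmetic operations, where the implied constant depends only on $n$. In particular, for $n = 2$ the cost is $\mathcal{O}(P^2 Q)$, which is the same complexity as that of the QR decomposition of the $Q \times P$ Jacobian matrix in a Gauss--Newton step.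
   Context: Setting. $E \subset \mathbf{R}$ is an interval and $\varTheta = E^P$ is the parameter domain. $\bar{\varphi}_0, \ldots, \bar{\varphi}_n$ are fixed univariate polynomials, $\bar{\varphi}_r$ of degree $r$, orthonormal with respect to a positive weight on $E$ (so $\bar{\varphi}_0$ is a nonzero constant); they and their derivatives are known in advance. Total degree space. The basis $\{\varphi_j\}_{j=1}^N$ consists of all products $$\varphi_j(\boldsymbol{\vartheta}) = \prod_{p=1}^P \bar{\varphi}_{\varLambda_{j,p}}(\vartheta_p),$$ where the rows $(\varLambda_{j,1}, \ldots, \varLambda_{j,P})$, $j = 1, \ldots, N$, of the degree matrix $\boldsymbol{\varLambda} \in \mathbf{N}_0^{N \times P}$ enumerate without repetition all multi-indices $(r_1, \ldots, r_P) \in \mathbf{N}_0^P$ with $\sum_{p=1}^P r_p \le n$. Thus $N = \binom{P+n}{n}$. Parametric solution. $\boldsymbol{U}(\boldsymbol{\vartheta}) = \boldsymbol{V}\boldsymbol{\varphi}(\boldsymbol{\vartheta})$ collects the values at $Q$ space-time observation points of a numerical solution of a parameter-dependent diffusion equation, expanded in the basis $\{\varphi_j\}$. The matrix $\boldsymbol{V} \in \mathbf{R}^{Q \times N}$ of expansion coefficients does not depend on $\boldsymbol{\vartheta}$, is computed beforehand, and may be regarded as an arbitrary given real matrix; its construction is not included in the cost. Cost model. The computational cost is the number of floating point (real arithmetic) operations needed for one given $\boldsymbol{\vartheta}$. The degree $n$ is regarded as fixed ($n = \mathcal{O}(1)$), while $P$ and $Q$ vary. The degree matrix $\boldsymbol{\varLambda}$,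 including the positions of its nonzero entries, and the required powers of the constant $\bar{\varphi}_0$ are known in advance. Gauss--Newton step. A Gauss--Newton step for minimizing $\lVert \boldsymbol{U}(\boldsymbol{\vartheta}) - \tilde{\boldsymbol{U}} \rVert_2^2$ (with given data $\tilde{\boldsymbol{U}} \in \mathbf{R}^Q$) solves the linear least squares problem $\min_{\boldsymbol{\varDelta} \in \mathbf{R}^P} \lVert \boldsymbol{J}_{\boldsymbol{U}}(\boldsymbol{\vartheta}) \boldsymbol{\varDelta} + \boldsymbol{U}(\boldsymbol{\vartheta}) - \tilde{\boldsymbol{U}} \rVert_2^2$ by a QR decomposition of the $Q \times P$ matrix $\boldsymbol{J}_{\boldsymbol{U}}(\boldsymbol{\vartheta})$; the complexity of this decomposition is the standard $\mathcal{O}(Q P^2)$. *)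

theory Defs
  imports
    "HOL-Analysis.Analysis"
    "HOL-Computational_Algebra.Polynomial"
    "Jordan_Normal_Form.Matrix_Kernel"
begin

unbundle no vec_syntax
no_notation inner (infix "\<bullet>" 70)


section \<open>Straight-line programs over the reals\<close>

text \<open>
  A program is a list of instructions, each of which is one real operation, so that the cost of
  a program is its length. The \<open>k\<close>-th instruction produces \<open>Result k\<close>. There are no literal
  constants: every number that is free of charge has to be declared as an input.
\<close>

datatype 'i operand = Input 'i | Result nat

datatype 'i instr =
    Add "'i operand" "'i operand"
  | Sub "'i operand" "'i operand"
  | Mul "'i operand" "'i operand"
  | Div "'i operand" "'i operand"
  | Sqrt "'i operand"

type_synonym 'i program = "'i instr list"

definition arithmetic_program :: "'i program \<Rightarrow> bool" where
  "arithmetic_program prog \<longleftrightarrow> (\<forall>a. Sqrt a \<notin> set prog)"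

fun operand_value :: "('i \<Rightarrow> real option) \<Rightarrow> real list \<Rightarrow> 'i operand \<Rightarrow> real option" where
  "operand_value env rs (Input i) = env i"
| "operand_value env rs (Result k) = (if k < length rs then Some (rs ! k) else None)"

text \<open>
  Execution fails (\<open>None\<close>) on undeclared inputs, forward references, division by zero and
  square roots of negative numbers; the total functions of HOL would let a program
  exploit values such as \<open>x / 0 = 0\<close>.
\<close>

fun instr_value :: "('i \<Rightarrow> real option) \<Rightarrow> real list \<Rightarrow> 'i instr \<Rightarrow> real option" where
  "instr_value env rs (Add a b) =
     Option.bind (operand_value env rs a) (\<lambda>x.
     Option.bind (operand_value env rs b) (\<lambda>y. Some (x + y)))"
| "instr_value env rs (Sub a b) =
     Option.bind (operand_value env rs a) (\<lambda>x.
     Option.bind (operand_value env rs b) (\<lambda>y. Some (x - y)))"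
| "instr_value env rs (Mul a b) =
     Option.bind (operand_value env rs a) (\<lambda>x.
     Option.bind (operand_value env rs b) (\<lambda>y. Some (x * y)))"
| "instr_value env rs (Div a b) =
     Option.bind (operand_value env rs a) (\<lambda>x.
     Option.bind (operand_value env rs b) (\<lambda>y. if y = 0 then None else Some (x / y)))"
| "instr_value env rs (Sqrt a) =
     Option.bind (operand_value env rs a) (\<lambda>x. if x < 0 then None else Some (sqrt x))"

fun run_from :: "('i \<Rightarrow> real option) \<Rightarrow> real list \<Rightarrow> 'i program \<Rightarrow> real list option" where
  "run_from env rs [] = Some rs"
| "run_from env rs (i # prog) =
     Option.bind (instr_value env rs i) (\<lambda>x. run_from env (rs @ [x]) prog)"

definition run :: "('i \<Rightarrow> real option) \<Rightarrow> 'i program \<Rightarrow> real list option" where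
  "run env prog = run_from env [] prog"


section \<open>Total degree basis and parametric solution\<close>

text \<open>Vectors and matrices are indexed from 0.\<close>

definition orthonormal_polys :: "real set \<Rightarrow> (real \<Rightarrow> real) \<Rightarrow> nat \<Rightarrow> (nat \<Rightarrow> real poly) \<Rightarrow> bool" where
  "orthonormal_polys E w n \<phi> \<longleftrightarrow>
     (\<forall>x\<in>E. 0 < w x) \<and>
     (\<forall>r\<le>n. degree (\<phi> r) = r) \<and>
     (\<forall>r\<le>n. \<forall>s\<le>n.
        set_integrable lborel E (\<lambda>x. poly (\<phi> r) x * poly (\<phi> s) x * w x) \<and>
        (LINT x:E|lborel. poly (\<phi> r) x * poly (\<phi> s) x * w x) = (if r = s then 1 else 0))"

definition total_degree_matrix :: "nat \<Rightarrow> nat \<Rightarrow> nat mat \<Rightarrow> bool" where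
  "total_degree_matrix n P \<Lambda> \<longleftrightarrow>
     dim_col \<Lambda> = P \<and>
     bij_betw (row \<Lambda>) {..<dim_row \<Lambda>} {r \<in> carrier_vec P. (\<Sum>p<P. r $ p) \<le> n}"

definition basis_vec :: "(nat \<Rightarrow> real poly) \<Rightarrow> nat mat \<Rightarrow> real vec \<Rightarrow> real vec" where
  "basis_vec \<phi> \<Lambda> \<theta> = vec (dim_row \<Lambda>) (\<lambda>j. \<Prod>p<dim_col \<Lambda>. poly (\<phi> (\<Lambda> $$ (j, p))) (\<theta> $ p))"

definition solution :: "real mat \<Rightarrow> (nat \<Rightarrow> real poly) \<Rightarrow> nat mat \<Rightarrow> real vec \<Rightarrow> real vec" where
  "solution V \<phi> \<Lambda> \<theta> = V *\<^sub>v basis_vec \<phi> \<Lambda> \<theta>"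

text \<open>
  The derivatives are two-sided also at end points of the interval, where they refer to the
  polynomial extension of the solution to the whole space.
\<close>

definition jacobian :: "(real vec \<Rightarrow> real vec) \<Rightarrow> real vec \<Rightarrow> real mat" where
  "jacobian F \<theta> = mat (dim_vec (F \<theta>)) (dim_vec \<theta>)
     (\<lambda>(q, p). deriv (\<lambda>t. F (\<theta> |\<^sub>v p \<mapsto> t) $ q) (\<theta> $ p))"

definition param_domain :: "real set \<Rightarrow> nat \<Rightarrow> real vec set" where
  "param_domain E P = {\<theta> \<in> carrier_vec P. \<forall>p<P. \<theta> $ p \<in> E}"


section \<open>Cost of evaluating the solution and its Jacobian\<close>

text \<open>
  Besides the parameters and the matrix \<open>V\<close>, the inputs contain what is known in advance:
  the coefficients of the univariate polynomials and of their derivatives, and the powers of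
  the constant polynomial. Values of the polynomials at the parameters are not inputs.
\<close>

datatype sol_input =
    Param nat
  | SolCoeff nat nat
  | PolyCoeff nat nat
  | DerivCoeff nat nat
  | ConstPow nat

fun sol_env :: "nat \<Rightarrow> (nat \<Rightarrow> real poly) \<Rightarrow> real mat \<Rightarrow> real vec \<Rightarrow> sol_input \<Rightarrow> real option" where
  "sol_env n \<phi> V \<theta> (Param p) = (if p < dim_vec \<theta> then Some (\<theta> $ p) else None)"
| "sol_env n \<phi> V \<theta> (SolCoeff q j) =
     (if q < dim_row V \<and> j < dim_col V then Some (V $$ (q, j)) else None)"
| "sol_env n \<phi> V \<theta> (PolyCoeff r k) = (if r \<le> n then Some (coeff (\<phi> r) k) else None)"
| "sol_env n \<phi> V \<theta> (DerivCoeff r k) = (if r \<le> n then Some (coeff (pderiv (\<phi> r)) k) else None)"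
| "sol_env n \<phi> V \<theta> (ConstPow k) = Some (coeff (\<phi> 0) 0 ^ k)"

definition computes_solution_and_jacobian ::
  "nat \<Rightarrow> nat \<Rightarrow> nat \<Rightarrow> real set \<Rightarrow> (nat \<Rightarrow> real poly) \<Rightarrow> nat mat \<Rightarrow> sol_input program \<Rightarrow>
   (nat \<Rightarrow> sol_input operand) \<Rightarrow> (nat \<Rightarrow> nat \<Rightarrow> sol_input operand) \<Rightarrow> bool" where
  "computes_solution_and_jacobian n P Q E \<phi> \<Lambda> prog outU outJ \<longleftrightarrow>
     (\<forall>V \<in> carrier_mat Q (dim_row \<Lambda>). \<forall>\<theta> \<in> param_domain E P.
        \<exists>rs. run (sol_env n \<phi> V \<theta>) prog = Some rs \<and>
          (\<forall>q<Q. operand_value (sol_env n \<phi> V \<theta>) rs (outU q) = Some (solution V \<phi> \<Lambda> \<theta> $ q)) \<and>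
          (\<forall>q<Q. \<forall>p<P. operand_value (sol_env n \<phi> V \<theta>) rs (outJ q p) =
             Some (jacobian (solution V \<phi> \<Lambda>) \<theta> $$ (q, p))))"

text \<open>
  The program may depend on the univariate polynomials and on the degree matrix, but it has to
  work for all coefficient matrices \<open>V\<close> and all parameters.
\<close>

definition solution_jacobian_cost_le :: "nat \<Rightarrow> nat \<Rightarrow> nat \<Rightarrow> real \<Rightarrow> bool" where
  "solution_jacobian_cost_le n P Q c \<longleftrightarrow>
     (\<forall>E w \<phi> \<Lambda>. is_interval E \<longrightarrow> orthonormal_polys E w n \<phi> \<longrightarrow> total_degree_matrix n P \<Lambda> \<longrightarrow>
        (\<exists>prog outU outJ. arithmetic_program prog \<and> real (length prog) \<le> c \<and>
           computes_solution_and_jacobian n P Q E \<phi> \<Lambda> prog outU outJ))"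


section \<open>Cost of a QR decomposition\<close>

text \<open>
  The matrix is required to have linearly independent columns, the case in which the least
  squares problem of a Gauss--Newton step has a unique solution. The square roots of
  the normalization are counted as one operation each.
\<close>

fun mat_env :: "real mat \<Rightarrow> nat \<times> nat \<Rightarrow> real option" where
  "mat_env A (i, j) = (if i < dim_row A \<and> j < dim_col A then Some (A $$ (i, j)) else None)"

definition computes_qr ::
  "nat \<Rightarrow> nat \<Rightarrow> (nat \<times> nat) program \<Rightarrow> (nat \<Rightarrow> nat \<Rightarrow> (nat \<times> nat) operand) \<Rightarrow>
   (nat \<Rightarrow> nat \<Rightarrow> (nat \<times> nat) operand) \<Rightarrow> bool" where
  "computes_qr P Q prog outB outR \<longleftrightarrow>
     (\<forall>A \<in> carrier_mat Q P. mat_kernel A = {0\<^sub>v P} \<longrightarrow>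
        (\<exists>rs. \<exists>B \<in> carrier_mat Q P. \<exists>R \<in> carrier_mat P P.
           run (mat_env A) prog = Some rs \<and>
           (\<forall>i<Q. \<forall>j<P. operand_value (mat_env A) rs (outB i j) = Some (B $$ (i, j))) \<and>
           (\<forall>i<P. \<forall>j<P. operand_value (mat_env A) rs (outR i j) = Some (R $$ (i, j))) \<and>
           B\<^sup>T * B = 1\<^sub>m P \<and> upper_triangular R \<and> A = B * R))"

definition qr_cost_le :: "nat \<Rightarrow> nat \<Rightarrow> real \<Rightarrow> bool" where
  "qr_cost_le P Q c \<longleftrightarrow>
     (\<exists>prog outB outR. real (length prog) \<le> c \<and> computes_qr P Q prog outB outR)"

end

theory Submission
  imports Defs
begin

text \<open>
  Two things make the Jacobian as cheap as the solution itself. A multi-index of total degree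
  at most \<open>n\<close> has at most \<open>n\<close> nonzero entries, so a basis function is a power of the constant
  polynomial times at most \<open>n\<close> univariate factors (\<open>active_bounds\<close>, \<open>prod_constant_outside\<close>),
  and its partial derivative with respect to any other coordinate vanishes. The \<open>N\<close> basis
  functions therefore have at most \<open>n * N\<close> nonzero partial derivatives altogether, each a product
  of at most \<open>n\<close> factors, and every one of these numbers enters only one multiplication and one
  addition per observation point. Besides the univariate values, which cost a multiple of \<open>P\<close>,
  this amounts to at most \<open>N * (n + 1) * n + 2 * Q * N * (n + 1)\<close> operations
  (\<open>exists_program_solution_jacobian\<close>). Finally \<open>N\<close> is a binomial coefficient and at most
  \<open>((n + 1) * P) ^ n\<close> (\<open>card_total_degree\<close>).

  The QR decomposition is computed by the Gram-Schmidt process: linear independence of the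
  columns keeps the divisors positive (\<open>gram_schmidt_step\<close>), and each of the \<open>P\<close> columns needs
  two passes over the at most \<open>P\<close> previous ones, at \<open>2 * Q\<close> operations per pass and
  previous column (\<open>qr_cost\<close>).

  Programs with explicit result positions are awkward to compose. All costs are therefore derived
  in a calculus whose objects are sets of real functions of the problem instance:
  \<open>cost_le F G k\<close> says that any program that has the functions in \<open>F\<close> at its disposal
  can be extended by \<open>k\<close> instructions to one that also delivers those in \<open>G\<close>.
\<close>

section \<open>Counting operations on functions instead of instructions\<close>

lemma run_from_append:
  "run_from e rs (p @ q) = Option.bind (run_from e rs p) (\<lambda>rs'. run_from e rs' q)"
proof (induction p arbitrary: rs)
  case (Cons i p)
  then show ?case by (cases "instr_value e rs i") auto
qed simp

lemma run_append: "run e (p @ q) = Option.bind (run e p) (\<lambda>rs. run_from e rs q)"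
  by (simp add: run_def run_from_append)

lemma run_from_extends: "run_from e rs q = Some rs' \<Longrightarrow> \<exists>zs. rs' = rs @ zs"
proof (induction q arbitrary: rs)
  case (Cons i q)
  then show ?case by (cases "instr_value e rs i") fastforce+
qed simp

lemma operand_value_append:
  "operand_value e rs a = Some y \<Longrightarrow> operand_value e (rs @ zs) a = Some y"
  by (cases a) (auto simp: nth_append split: if_splits)

lemma run_from_length: "run_from e rs q = Some rs' \<Longrightarrow> length rs' = length rs + length q"
proof (induction q arbitrary: rs)
  case (Cons i q)
  then show ?case by (cases "instr_value e rs i") fastforce+
qed simp

lemma run_length: "run e q = Some rs \<Longrightarrow> length rs = length q"
  using run_from_length by (fastforce simp: run_def)

text \<open>
  The points of \<open>D\<close> are the problem instances on which one and the same program has to succeed.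
  The flag \<open>roots\<close> permits square roots, so that one calculus serves both cost models.
\<close>

locale straight_line =
  fixes env :: "'x \<Rightarrow> 'i \<Rightarrow> real option" and D :: "'x set" and roots :: bool
begin

text \<open>
  The operand is chosen before the instance: the position of a value in the results must not
  depend on the data.
\<close>

definition provides :: "'i program \<Rightarrow> ('x \<Rightarrow> real) set \<Rightarrow> bool" where
  "provides prog F \<longleftrightarrow> (\<exists>rs. (\<forall>x\<in>D. run (env x) prog = Some (rs x)) \<and>
     (\<forall>f\<in>F. \<exists>a. \<forall>x\<in>D. operand_value (env x) (rs x) a = Some (f x)))"

definition cost_le :: "('x \<Rightarrow> real) set \<Rightarrow> ('x \<Rightarrow> real) set \<Rightarrow> nat \<Rightarrow> bool" where
  "cost_le F G k \<longleftrightarrow> (\<forall>prog. provides prog F \<longrightarrow>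
     (\<exists>ext. length ext \<le> k \<and> (roots \<or> arithmetic_program ext) \<and> provides (prog @ ext) G))"

lemma provides_subset: "provides p F \<Longrightarrow> G \<subseteq> F \<Longrightarrow> provides p G"
  unfolding provides_def by blast

text \<open>
  Results are only ever appended, so whatever was available stays available at the same
  position; this is what makes costs additive.
\<close>

lemma provides_append:
  assumes "provides p F" "provides (p @ q) G"
  shows "provides (p @ q) (F \<union> G)"
proof -
  obtain rs where rs: "\<And>x. x \<in> D \<Longrightarrow> run (env x) p = Some (rs x)"
    and F: "\<And>f. f \<in> F \<Longrightarrow> \<exists>a. \<forall>x\<in>D. operand_value (env x) (rs x) a = Some (f x)"
    using assms(1) unfolding provides_def by blast
  obtain rs' where rs': "\<And>x. x \<in> D \<Longrightarrow> run (env x) (p @ q) = Some (rs' x)"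
    and G: "\<And>f. f \<in> G \<Longrightarrow> \<exists>a. \<forall>x\<in>D. operand_value (env x) (rs' x) a = Some (f x)"
    using assms(2) unfolding provides_def by blast
  have "\<exists>zs. rs' x = rs x @ zs" if "x \<in> D" for x
    using rs[OF that] rs'[OF that] run_from_extends by (auto simp: run_append)
  then have keep: "operand_value (env x) (rs' x) a = Some y"
    if "x \<in> D" "operand_value (env x) (rs x) a = Some y" for x a y
    using that operand_value_append by metis
  have "\<exists>a. \<forall>x\<in>D. operand_value (env x) (rs' x) a = Some (f x)" if "f \<in> F \<union> G" for f
  proof (cases "f \<in> F")
    case True
    then show ?thesis using F[OF True] keep by blast
  next
    case False
    then show ?thesis using that G by blast
  qed
  then show ?thesis unfolding provides_def using rs' by blast
qed

lemma provides_inputs: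
  assumes "\<And>f. f \<in> F \<Longrightarrow> \<exists>i. \<forall>x\<in>D. env x i = Some (f x)"
  shows "provides [] F"
proof -
  have "\<exists>a. \<forall>x\<in>D. operand_value (env x) [] a = Some (f x)" if "f \<in> F" for f
    using assms[OF that] by (metis operand_value.simps(1))
  then show ?thesis by (auto simp: provides_def run_def)
qed

lemma cost_le_program:
  assumes "provides [] F" "cost_le F G k"
  shows "\<exists>prog. length prog \<le> k \<and> (roots \<or> arithmetic_program prog) \<and> provides prog G"
  using assms unfolding cost_le_def by force

text \<open>
  All runs of a program have the same length, so the new result occupies the same position
  for every instance. For \<open>Sqrt\<close> the second operand is a dummy.
\<close>

lemma cost_le_instr:
  assumes "f \<in> F" "g \<in> F"
    and val: "\<And>a b rs x. x \<in> D \<Longrightarrow> operand_value (env x) rs a = Some (f x) \<Longrightarrow>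
      operand_value (env x) rs b = Some (g x) \<Longrightarrow> instr_value (env x) rs (I a b) = Some (h x)"
    and arith: "\<And>a b c. roots \<or> I a b \<noteq> Sqrt c"
  shows "cost_le F {h} 1"
  unfolding cost_le_def
proof (intro allI impI)
  fix p assume "provides p F"
  then obtain rs where rs: "\<And>x. x \<in> D \<Longrightarrow> run (env x) p = Some (rs x)"
    and F: "\<And>f. f \<in> F \<Longrightarrow> \<exists>a. \<forall>x\<in>D. operand_value (env x) (rs x) a = Some (f x)"
    unfolding provides_def by blast
  obtain a where a: "\<And>x. x \<in> D \<Longrightarrow> operand_value (env x) (rs x) a = Some (f x)"
    using F[OF assms(1)] by blast
  obtain b where b: "\<And>x. x \<in> D \<Longrightarrow> operand_value (env x) (rs x) b = Some (g x)"
    using F[OF assms(2)] by blast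
  have "run (env x) (p @ [I a b]) = Some (rs x @ [h x])" if "x \<in> D" for x
    using val[OF that a[OF that] b[OF that]] rs[OF that] by (simp add: run_append)
  moreover have "operand_value (env x) (rs x @ [h x]) (Result (length p)) = Some (h x)"
    if "x \<in> D" for x
    using run_length[OF rs[OF that]] by (simp add: nth_append)
  ultimately have "provides (p @ [I a b]) {h}"
    unfolding provides_def by (intro exI[of _ "\<lambda>x. rs x @ [h x]"]) blast
  moreover have "roots \<or> arithmetic_program [I a b]"
    using arith by (auto simp: arithmetic_program_def) metis
  ultimately show "\<exists>ext. length ext \<le> 1 \<and> (roots \<or> arithmetic_program ext) \<and>
      provides (p @ ext) {h}"
    by (intro exI[of _ "[I a b]"]) simp
qed

lemma cost_le_add: "f \<in> F \<Longrightarrow> g \<in> F \<Longrightarrow> cost_le F {\<lambda>x. f x + g x} 1"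
  by (rule cost_le_instr[of f F g Add]) auto

lemma cost_le_diff: "f \<in> F \<Longrightarrow> g \<in> F \<Longrightarrow> cost_le F {\<lambda>x. f x - g x} 1"
  by (rule cost_le_instr[of f F g Sub]) auto

lemma cost_le_mult: "f \<in> F \<Longrightarrow> g \<in> F \<Longrightarrow> cost_le F {\<lambda>x. f x * g x} 1"
  by (rule cost_le_instr[of f F g Mul]) auto

lemma cost_le_divide:
  "f \<in> F \<Longrightarrow> g \<in> F \<Longrightarrow> (\<And>x. x \<in> D \<Longrightarrow> g x \<noteq> 0) \<Longrightarrow> cost_le F {\<lambda>x. f x / g x} 1"
  by (rule cost_le_instr[of f F g Div]) auto

lemma cost_le_sqrt:
  "roots \<Longrightarrow> f \<in> F \<Longrightarrow> (\<And>x. x \<in> D \<Longrightarrow> f x \<ge> 0) \<Longrightarrow> cost_le F {\<lambda>x. sqrt (f x)} 1"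
  by (rule cost_le_instr[of f F f "\<lambda>a b. Sqrt a"]) (auto simp: not_less[symmetric])

lemma cost_le_mono:
  assumes "cost_le F G k" "F \<subseteq> F'" "G' \<subseteq> G" "k \<le> l"
  shows "cost_le F' G' l"
  unfolding cost_le_def
proof (intro allI impI)
  fix p assume "provides p F'"
  then have "provides p F" using assms(2) provides_subset by blast
  then obtain ext where "length ext \<le> k" "roots \<or> arithmetic_program ext" "provides (p @ ext) G"
    using assms(1) unfolding cost_le_def by blast
  then show "\<exists>ext. length ext \<le> l \<and> (roots \<or> arithmetic_program ext) \<and> provides (p @ ext) G'"
    using assms(3,4) provides_subset by (metis le_trans)
qed

lemma cost_le_refl: "G \<subseteq> F \<Longrightarrow> cost_le F G 0"
  unfolding cost_le_def
  by (intro allI impI exI[of _ "[]"]) (auto simp: arithmetic_program_def intro: provides_subset)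

lemma cost_le_trans:
  assumes "cost_le F G k" "cost_le (F \<union> G) H l"
  shows "cost_le F (G \<union> H) (k + l)"
  unfolding cost_le_def
proof (intro allI impI)
  fix p assume F: "provides p F"
  obtain q where q: "length q \<le> k" "roots \<or> arithmetic_program q" "provides (p @ q) G"
    using F assms(1) unfolding cost_le_def by blast
  then have "provides (p @ q) (F \<union> G)" using F provides_append by blast
  then obtain r where r: "length r \<le> l" "roots \<or> arithmetic_program r"
      "provides ((p @ q) @ r) H"
    using assms(2) unfolding cost_le_def by blast
  then have "provides (p @ (q @ r)) (G \<union> H)" using q(3) provides_append by fastforce
  moreover have "roots \<or> arithmetic_program (q @ r)"
    using q(2) r(2) by (auto simp: arithmetic_program_def)
  ultimately show "\<exists>ext. length ext \<le> k + l \<and> (roots \<or> arithmetic_program ext) \<and>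
      provides (p @ ext) (G \<union> H)"
    using q(1) r(1) by (intro exI[of _ "q @ r"]) simp
qed

lemma cost_le_then:
  assumes "cost_le F G k" "cost_le (F \<union> G) H l" "k + l \<le> m"
  shows "cost_le F H m"
  by (rule cost_le_mono[OF cost_le_trans[OF assms(1,2)]]) (use assms(3) in auto)

lemma cost_le_UN:
  assumes "finite I" "\<And>i. i \<in> I \<Longrightarrow> cost_le F (G i) (k i)"
  shows "cost_le F (\<Union>i\<in>I. G i) (\<Sum>i\<in>I. k i)"
  using assms
proof (induction I rule: finite_induct)
  case empty
  show ?case by (simp add: cost_le_refl)
next
  case (insert i I)
  have "cost_le F (G i \<union> (\<Union>i\<in>I. G i)) (k i + (\<Sum>i\<in>I. k i))"
  proof (rule cost_le_trans)
    show "cost_le F (G i) (k i)" by (rule insert.prems) simp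
    show "cost_le (F \<union> G i) (\<Union>i\<in>I. G i) (\<Sum>i\<in>I. k i)"
      by (rule cost_le_mono[OF insert.IH[OF insert.prems]]) auto
  qed
  then show ?case using insert by simp
qed

lemma cost_le_image:
  assumes "finite I" "\<And>i. i \<in> I \<Longrightarrow> cost_le F {g i} k" "card I * k \<le> l"
  shows "cost_le F (g ` I) l"
proof -
  have "cost_le F (\<Union>i\<in>I. {g i}) (\<Sum>i\<in>I. k)"
    using assms(1,2) by (rule cost_le_UN)
  then show ?thesis by (rule cost_le_mono) (use assms(3) in auto)
qed

text \<open>For iterative algorithms, where a stage works with the results of all earlier ones.\<close>

lemma cost_le_sequence:
  assumes "\<And>j. j < m \<Longrightarrow> cost_le (F \<union> (\<Union>i<j. G i)) (G j) k"
  shows "cost_le F (\<Union>i<m. G i) (m * k)"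
  using assms
proof (induction m)
  case 0
  show ?case by (simp add: cost_le_refl)
next
  case (Suc m)
  have "cost_le F ((\<Union>i<m. G i) \<union> G m) (m * k + k)"
  proof (rule cost_le_trans)
    show "cost_le F (\<Union>i<m. G i) (m * k)" by (rule Suc.IH[OF Suc.prems]) simp
    show "cost_le (F \<union> (\<Union>i<m. G i)) (G m) k" by (rule Suc.prems) simp
  qed
  then show ?case by (simp add: lessThan_Suc Un_commute add.commute)
qed

lemma cost_le_dot_product:
  assumes "finite I" "\<And>i. i \<in> I \<Longrightarrow> f i \<in> F" "\<And>i. i \<in> I \<Longrightarrow> g i \<in> F" "(\<lambda>_. 0) \<in> F"
  shows "cost_le F {\<lambda>x. \<Sum>i\<in>I. f i x * g i x} (2 * card I)"
  using assms(1-3)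
proof (induction I rule: finite_induct)
  case empty
  show ?case using assms(4) by (simp add: cost_le_refl)
next
  case (insert i I)
  let ?s = "\<lambda>x. \<Sum>i\<in>I. f i x * g i x"
  have *: "cost_le (F \<union> {?s}) {\<lambda>x. f i x * g i x + ?s x} 2"
    by (rule cost_le_then[OF cost_le_mult[of "f i" _ "g i"] cost_le_add])
      (use insert.prems in auto)
  have "cost_le F {\<lambda>x. f i x * g i x + ?s x} (2 * card (insert i I))"
    by (rule cost_le_then[OF insert.IH *]) (use insert in auto)
  then show ?case using insert by simp
qed

lemma cost_le_prod:
  assumes "finite I" "\<And>i. i \<in> I \<Longrightarrow> f i \<in> F" "c \<in> F"
  shows "cost_le F {\<lambda>x. c x * (\<Prod>i\<in>I. f i x)} (card I)"
  using assms(1,2)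
proof (induction I rule: finite_induct)
  case empty
  show ?case using assms(3) by (simp add: cost_le_refl)
next
  case (insert i I)
  let ?s = "\<lambda>x. c x * (\<Prod>i\<in>I. f i x)"
  have "cost_le F {\<lambda>x. f i x * ?s x} (card (insert i I))"
    by (rule cost_le_then[OF insert.IH cost_le_mult]) (use insert in auto)
  then show ?case using insert by (simp add: mult.left_commute)
qed

text \<open>Horner's rule.\<close>

lemma cost_le_poly:
  assumes "degree p \<le> d" "\<And>k. (\<lambda>_. coeff p k) \<in> F" "t \<in> F"
  shows "cost_le F {\<lambda>x. poly p (t x)} (2 * d)"
  using assms(1,2)
proof (induction d arbitrary: p)
  case 0
  then obtain a where "p = [:a:]" using degree_eq_zeroE by blast
  then show ?case using 0(2)[of 0] by (simp add: cost_le_refl)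
next
  case (Suc d)
  obtain a p' where p: "p = pCons a p'" by (cases p)
  have deg: "degree p' \<le> d"
    using Suc.prems(1) by (cases "p' = 0") (auto simp: p)
  have coeffs: "(\<lambda>_. coeff p' k) \<in> F" for k using Suc.prems(2)[of "Suc k"] by (simp add: p)
  have a: "(\<lambda>_. a) \<in> F" using Suc.prems(2)[of 0] by (simp add: p)
  let ?h = "\<lambda>x. poly p' (t x)"
  have *: "cost_le (F \<union> {?h}) {\<lambda>x. a + t x * ?h x} 2"
    by (rule cost_le_then[OF cost_le_mult[of t _ ?h] cost_le_add[of "\<lambda>_. a"]])
      (use assms(3) a in auto)
  have "cost_le F {\<lambda>x. a + t x * ?h x} (2 * Suc d)"
    by (rule cost_le_then[OF Suc.IH[OF deg coeffs] *]) auto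
  then show ?case by (simp add: p)
qed

end

section \<open>The total degree basis\<close>

text \<open>
  The slack \<open>n - (\<Sum>p<P. r $ p)\<close>, added as a further entry, turns the multi-indices of degree at most
  \<open>n\<close> into lists of length \<open>P + 1\<close> with sum exactly \<open>n\<close>, whose number is \<open>n + P choose n\<close>.
\<close>

lemma card_total_degree:
  "card {r \<in> carrier_vec P. (\<Sum>p<P. r $ p) \<le> (n::nat)} \<le> (n + P) ^ n"
proof -
  let ?S = "{r \<in> carrier_vec P. (\<Sum>p<P. r $ p) \<le> n}"
  let ?L = "{l::nat list. length l = Suc P \<and> sum_list l = n}"
  let ?f = "\<lambda>r. (n - (\<Sum>p<P. r $ p)) # list_of_vec r"
  have sl: "sum_list (list_of_vec r) = (\<Sum>p<P. r $ p)" if "r \<in> carrier_vec P" for r :: "nat vec"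
    using that by (auto simp: sum_list_sum_nth list_of_vec_index atLeast0LessThan)
  have "inj_on ?f ?S"
    by (rule inj_onI) (metis list.inject vec_list)
  moreover have "?f ` ?S \<subseteq> ?L" using sl by auto
  moreover have "finite ?L"
  proof (rule finite_subset)
    show "?L \<subseteq> {l. set l \<subseteq> {..n} \<and> length l = Suc P}"
      using member_le_sum_list by auto
    show "finite {l. set l \<subseteq> {..n} \<and> length l = Suc P}" by (simp add: finite_lists_length_eq)
  qed
  ultimately have "card ?S \<le> card ?L" using card_inj_on_le by blast
  also have "card ?L = (n + P) choose n"
    using card_length_sum_list[of "Suc P" n] by simp
  also have "\<dots> \<le> (n + P) ^ n" by (rule binomial_le_pow) simp
  finally show ?thesis .
qed

definition active :: "nat mat \<Rightarrow> nat \<Rightarrow> nat set" where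
  "active \<Lambda> j = {p. p < dim_col \<Lambda> \<and> \<Lambda> $$ (j, p) \<noteq> 0}"

lemma total_degree_rows:
  assumes "total_degree_matrix n P \<Lambda>"
  shows "dim_col \<Lambda> = P" "dim_row \<Lambda> \<le> (n + P) ^ n"
    and "j < dim_row \<Lambda> \<Longrightarrow> (\<Sum>p<P. \<Lambda> $$ (j, p)) \<le> n"
proof -
  have bij: "bij_betw (row \<Lambda>) {..<dim_row \<Lambda>} {r \<in> carrier_vec P. (\<Sum>p<P. r $ p) \<le> n}"
    and col: "dim_col \<Lambda> = P"
    using assms by (auto simp: total_degree_matrix_def)
  show "dim_col \<Lambda> = P" by fact
  show "dim_row \<Lambda> \<le> (n + P) ^ n"
    using bij_betw_same_card[OF bij] card_total_degree[of P n] by simp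
  show "(\<Sum>p<P. \<Lambda> $$ (j, p)) \<le> n" if "j < dim_row \<Lambda>"
    using bij_betwE[OF bij] that col by auto
qed

lemma active_bounds:
  assumes "total_degree_matrix n P \<Lambda>" "j < dim_row \<Lambda>"
  shows "active \<Lambda> j \<subseteq> {..<P}" "finite (active \<Lambda> j)" "card (active \<Lambda> j) \<le> n"
    and "p < P \<Longrightarrow> \<Lambda> $$ (j, p) \<le> n"
proof -
  note rows = total_degree_rows[OF assms(1)]
  show sub: "active \<Lambda> j \<subseteq> {..<P}" using rows(1) by (auto simp: active_def)
  show fin: "finite (active \<Lambda> j)" using sub finite_subset by blast
  have "card (active \<Lambda> j) = (\<Sum>p\<in>active \<Lambda> j. 1)" by simp
  also have "\<dots> \<le> (\<Sum>p\<in>active \<Lambda> j. \<Lambda> $$ (j, p))"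
    by (rule sum_mono) (auto simp: active_def)
  also have "\<dots> \<le> (\<Sum>p<P. \<Lambda> $$ (j, p))" by (rule sum_mono2) (use sub in auto)
  also have "\<dots> \<le> n" by (rule rows(3)[OF assms(2)])
  finally show "card (active \<Lambda> j) \<le> n" .
  show "\<Lambda> $$ (j, p) \<le> n" if "p < P"
    using member_le_sum[of p "{..<P}" "\<lambda>p. \<Lambda> $$ (j, p)"] that rows(3)[OF assms(2)] by force
qed

lemma prod_constant_outside:
  fixes g :: "nat \<Rightarrow> 'a::comm_monoid_mult"
  assumes "S \<subseteq> {..<P}" "\<And>p. p < P \<Longrightarrow> p \<notin> S \<Longrightarrow> g p = c"
  shows "(\<Prod>p<P. g p) = c ^ (P - card S) * (\<Prod>p\<in>S. g p)"
proof -
  have "(\<Prod>p<P. g p) = (\<Prod>p\<in>{..<P} - S. g p) * (\<Prod>p\<in>S. g p)"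
    using assms(1) by (intro prod.subset_diff) auto
  also have "(\<Prod>p\<in>{..<P} - S. g p) = (\<Prod>p\<in>{..<P} - S. c)"
    by (rule prod.cong) (use assms(2) in auto)
  also have "\<dots> = c ^ (P - card S)"
    using assms(1) by (simp add: card_Diff_subset finite_subset[OF assms(1)])
  finally show ?thesis .
qed

lemma solution_index:
  assumes "V \<in> carrier_mat Q (dim_row \<Lambda>)" "q < Q"
  shows "solution V \<phi> \<Lambda> \<theta> $ q =
    (\<Sum>j<dim_row \<Lambda>. V $$ (q, j) * (\<Prod>p<dim_col \<Lambda>. poly (\<phi> (\<Lambda> $$ (j, p))) (\<theta> $ p)))"
  using assms
  by (auto simp: solution_def basis_vec_def scalar_prod_def atLeast0LessThan intro!: sum.cong)

text \<open>
  The product rule is trivial here, because each coordinate occurs in only one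
  univariate factor of a basis function.
\<close>

lemma jacobian_index:
  assumes "V \<in> carrier_mat Q (dim_row \<Lambda>)" "\<theta> \<in> carrier_vec P" "dim_col \<Lambda> = P" "q < Q" "p < P"
  shows "jacobian (solution V \<phi> \<Lambda>) \<theta> $$ (q, p) =
    (\<Sum>j<dim_row \<Lambda>. V $$ (q, j) * (\<Prod>p'<P. if p' = p then poly (pderiv (\<phi> (\<Lambda> $$ (j, p)))) (\<theta> $ p)
       else poly (\<phi> (\<Lambda> $$ (j, p'))) (\<theta> $ p')))"
proof -
  define rest where "rest = (\<lambda>j. \<Prod>p'\<in>{..<P} - {p}. poly (\<phi> (\<Lambda> $$ (j, p'))) (\<theta> $ p'))"
  have split: "(\<Prod>p'<P. g p') = g p * (\<Prod>p'\<in>{..<P} - {p}. g p')" for g :: "nat \<Rightarrow> real"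
    by (rule prod.remove) (use assms(5) in auto)
  have "solution V \<phi> \<Lambda> (\<theta> |\<^sub>v p \<mapsto> t) $ q =
      (\<Sum>j<dim_row \<Lambda>. V $$ (q, j) * (poly (\<phi> (\<Lambda> $$ (j, p))) t * rest j))" for t
  proof -
    have "(\<Prod>p'\<in>{..<P} - {p}. poly (\<phi> (\<Lambda> $$ (j, p'))) ((\<theta> |\<^sub>v p \<mapsto> t) $ p')) = rest j" for j
      unfolding rest_def by (rule prod.cong) (use assms in auto)
    moreover have "(\<theta> |\<^sub>v p \<mapsto> t) $ p = t" using assms by auto
    ultimately show ?thesis
      using assms(3) by (simp add: solution_index[OF assms(1,4)] split)
  qed
  then have "((\<lambda>t. solution V \<phi> \<Lambda> (\<theta> |\<^sub>v p \<mapsto> t) $ q) has_field_derivative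
      (\<Sum>j<dim_row \<Lambda>. V $$ (q, j) * (poly (pderiv (\<phi> (\<Lambda> $$ (j, p)))) (\<theta> $ p) * rest j)))
      (at (\<theta> $ p))"
    by (auto intro!: derivative_eq_intros sum.cong)
  then have "deriv (\<lambda>t. solution V \<phi> \<Lambda> (\<theta> |\<^sub>v p \<mapsto> t) $ q) (\<theta> $ p) =
      (\<Sum>j<dim_row \<Lambda>. V $$ (q, j) * (poly (pderiv (\<phi> (\<Lambda> $$ (j, p)))) (\<theta> $ p) * rest j))"
    by (rule DERIV_imp_deriv)
  moreover have "dim_vec (solution V \<phi> \<Lambda> \<theta>) = Q" "dim_vec \<theta> = P"
    using assms(1,2) by (auto simp: solution_def)
  moreover have "(\<Prod>p'\<in>{..<P} - {p}. if p' = p then y else poly (\<phi> (\<Lambda> $$ (j, p'))) (\<theta> $ p')) = rest j"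
    for j y unfolding rest_def by (rule prod.cong) auto
  ultimately show ?thesis using assms(4,5) by (simp add: jacobian_def split)
qed

lemma orthonormal_degree: "orthonormal_polys E w n \<phi> \<Longrightarrow> r \<le> n \<Longrightarrow> degree (\<phi> r) = r"
  by (simp add: orthonormal_polys_def)

section \<open>Evaluating the solution and its Jacobian\<close>

lemma exists_program_solution_jacobian:
  assumes degree: "\<And>r. r \<le> n \<Longrightarrow> degree (\<phi> r) = r" and matrix: "total_degree_matrix n P \<Lambda>"
  shows "\<exists>prog outU outJ. arithmetic_program prog \<and>
    length prog \<le> 4 * n * (n + 1) * P + dim_row \<Lambda> * (n + 1) * n + 2 * Q * dim_row \<Lambda> * (n + 1) \<and>
    computes_solution_and_jacobian n P Q E \<phi> \<Lambda> prog outU outJ"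
proof -
  define N where "N = dim_row \<Lambda>"
  define D :: "(real mat \<times> real vec) set" where "D = carrier_mat Q N \<times> param_domain E P"
  interpret straight_line "\<lambda>x. sol_env n \<phi> (fst x) (snd x)" D False .
  define S where "S = active \<Lambda>"
  have col: "dim_col \<Lambda> = P" using total_degree_rows(1)[OF matrix] .
  have S: "S j \<subseteq> {..<P}" "finite (S j)" "card (S j) \<le> n" if "j < N" for j
    using active_bounds[OF matrix] that by (auto simp: S_def N_def)
  have entry: "\<Lambda> $$ (j, p) \<le> n" if "j < N" "p < P" for j p
    using active_bounds(4)[OF matrix] that by (simp add: N_def)

  define c where "c = coeff (\<phi> 0) 0"
  have phi0: "\<phi> 0 = [:c:]"
  proof -
    have "degree (\<phi> 0) = 0" using degree[of 0] by simp
    then obtain a where "\<phi> 0 = [:a:]" by (rule degree_eq_zeroE)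
    then show ?thesis by (simp add: c_def)
  qed

  define const :: "real \<Rightarrow> real mat \<times> real vec \<Rightarrow> real" where "const = (\<lambda>a _. a)"
  define par :: "nat \<Rightarrow> real mat \<times> real vec \<Rightarrow> real" where "par = (\<lambda>p x. snd x $ p)"
  define ent :: "nat \<times> nat \<Rightarrow> real mat \<times> real vec \<Rightarrow> real" where "ent = (\<lambda>i x. fst x $$ i)"
  define F0 where "F0 = par ` {..<P} \<union> ent ` ({..<Q} \<times> {..<N}) \<union>
     {const (coeff (\<phi> r) k) |r k. r \<le> n} \<union> {const (coeff (pderiv (\<phi> r)) k) |r k. r \<le> n} \<union>
     range (\<lambda>k. const (c ^ k))"
  have inputs: "provides [] F0"
  proof (rule provides_inputs)
    fix f assume "f \<in> F0"
    then consider p where "f = par p" "p < P" | q j where "f = ent (q, j)" "q < Q" "j < N"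
      | r k where "f = const (coeff (\<phi> r) k)" "r \<le> n"
      | r k where "f = const (coeff (pderiv (\<phi> r)) k)" "r \<le> n"
      | k where "f = const (c ^ k)"
      unfolding F0_def by blast
    then show "\<exists>i. \<forall>x\<in>D. sol_env n \<phi> (fst x) (snd x) i = Some (f x)"
    proof cases
      case 1 then show ?thesis
        by (intro exI[of _ "Param p"]) (auto simp: par_def D_def param_domain_def)
    next
      case 2 then show ?thesis
        by (intro exI[of _ "SolCoeff q j"]) (auto simp: ent_def D_def)
    next
      case 3 then show ?thesis by (intro exI[of _ "PolyCoeff r k"]) (auto simp: const_def)
    next
      case 4 then show ?thesis by (intro exI[of _ "DerivCoeff r k"]) (auto simp: const_def)
    next
      case 5 then show ?thesis by (intro exI[of _ "ConstPow k"]) (auto simp: const_def c_def)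
    qed
  qed
  \<comment> \<open>The sums start from zero, which is available as a vanishing coefficient.\<close>
  have "coeff (\<phi> 0) 1 = 0" using degree[of 0] by (intro coeff_eq_0) simp
  then have "const 0 \<in> F0" unfolding F0_def by (metis (mono_tags, lifting) UnI1 UnI2 le0 mem_Collect_eq)
  then have zero: "(\<lambda>_. 0) \<in> F0" by (simp add: const_def)

  define val where "val = (\<lambda>(p, r) x. poly (\<phi> r) (par p x))"
  define der where "der = (\<lambda>(p, r) x. poly (pderiv (\<phi> r)) (par p x))"
  define I1 where "I1 = {..<P} \<times> {..n}"
  define F1 where "F1 = val ` I1 \<union> der ` I1"
  have cost1: "cost_le F0 F1 (4 * n * (n + 1) * P)"
  proof -
    have deg: "degree (\<phi> r) \<le> n" "degree (pderiv (\<phi> r)) \<le> n" if "r \<le> n" for r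
      using degree[OF that] that by (auto simp: degree_pderiv)
    have v: "cost_le F0 {val i} (2 * n)" and d: "cost_le F0 {der i} (2 * n)" if i: "i \<in> I1" for i
    proof -
      obtain p r where pr: "i = (p, r)" "p < P" "r \<le> n" using i by (auto simp: I1_def)
      have par: "par p \<in> F0" using pr by (simp add: F0_def)
      have "(\<lambda>_. coeff (\<phi> r) k) \<in> F0" for k
        using pr(3) unfolding F0_def const_def by blast
      from cost_le_poly[OF deg(1)[OF pr(3)] this par]
      show "cost_le F0 {val i} (2 * n)" by (simp add: val_def pr(1))
      have "(\<lambda>_. coeff (pderiv (\<phi> r)) k) \<in> F0" for k
        using pr(3) unfolding F0_def const_def by blast
      from cost_le_poly[OF deg(2)[OF pr(3)] this par]
      show "cost_le F0 {der i} (2 * n)" by (simp add: der_def pr(1))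
    qed
    have fin: "finite I1" and card: "card I1 * (2 * n) \<le> 2 * n * (n + 1) * P"
      by (auto simp: I1_def algebra_simps)
    have "cost_le F0 (val ` I1 \<union> der ` I1) (2 * n * (n + 1) * P + 2 * n * (n + 1) * P)"
      by (rule cost_le_trans[OF cost_le_image[OF fin v card] cost_le_mono[OF cost_le_image[OF fin d card]]])
        auto
    then show ?thesis by (rule cost_le_mono) (auto simp: F1_def algebra_simps)
  qed

  \<comment> \<open>Only partial derivatives with respect to active coordinates are formed; the others vanish.\<close>
  define bas where "bas = (\<lambda>j x. const (c ^ (P - card (S j))) x *
     (\<Prod>p\<in>S j. val (p, \<Lambda> $$ (j, p)) x))"
  define dbas where "dbas = (\<lambda>(j, p) x. const (c ^ (P - card (S j))) x *
     (\<Prod>p'\<in>S j. (if p' = p then der (p', \<Lambda> $$ (j, p')) else val (p', \<Lambda> $$ (j, p'))) x))"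
  define I2 where "I2 = (SIGMA j:{..<N}. S j)"
  define F2 where "F2 = bas ` {..<N} \<union> dbas ` I2"
  have cost2: "cost_le (F0 \<union> F1) F2 (N * (n + 1) * n)"
  proof -
    have ins: "val (p, \<Lambda> $$ (j, p)) \<in> F1" "der (p, \<Lambda> $$ (j, p)) \<in> F1"
      if "j < N" "p \<in> S j" for j p
    proof -
      have "(p, \<Lambda> $$ (j, p)) \<in> I1" using that S(1) entry by (force simp: I1_def)
      then show "val (p, \<Lambda> $$ (j, p)) \<in> F1" "der (p, \<Lambda> $$ (j, p)) \<in> F1"
        unfolding F1_def by blast+
    qed
    have pow: "const (c ^ k) \<in> F0 \<union> F1" for k by (simp add: F0_def)
    have b: "cost_le (F0 \<union> F1) {bas j} n" if "j \<in> {..<N}" for j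
      unfolding bas_def
      by (rule cost_le_mono[OF cost_le_prod[OF S(2) _ pow]]) (use that ins S in auto)
    have d: "cost_le (F0 \<union> F1) {dbas i} n" if "i \<in> I2" for i
    proof -
      obtain j p where jp: "i = (j, p)" "j < N" using \<open>i \<in> I2\<close> by (auto simp: I2_def)
      show ?thesis
        unfolding dbas_def jp prod.case
        by (rule cost_le_mono[OF cost_le_prod[OF S(2) _ pow]]) (use jp ins S in auto)
    qed
    have fin: "finite I2" using S by (auto simp: I2_def)
    have "card I2 = (\<Sum>j<N. card (S j))" using S by (simp add: I2_def)
    also have "\<dots> \<le> (\<Sum>j<N. n)" by (rule sum_mono) (use S in auto)
    finally have "card I2 * n \<le> N * n * n" by simp
    from cost_le_image[OF fin d this]
    have "cost_le (F0 \<union> F1 \<union> bas ` {..<N}) (dbas ` I2) (N * n * n)"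
      by (rule cost_le_mono) auto
    from cost_le_trans[OF cost_le_image[OF finite_lessThan b order_refl] this]
    show ?thesis by (rule cost_le_mono) (auto simp: F2_def algebra_simps)
  qed

  define U where "U = (\<lambda>q x. \<Sum>j<N. ent (q, j) x * bas j x)"
  define J where "J = (\<lambda>(q, p) x. \<Sum>j\<in>{j\<in>{..<N}. p \<in> S j}. ent (q, j) x * dbas (j, p) x)"
  define F3 where "F3 = U ` {..<Q} \<union> J ` ({..<Q} \<times> {..<P})"
  have cost3: "cost_le (F0 \<union> (F1 \<union> F2)) F3 (2 * Q * N * (n + 1))"
  proof -
    let ?F = "F0 \<union> (F1 \<union> F2)"
    have ent: "ent (q, j) \<in> ?F" if "q < Q" "j < N" for q j
      using that by (auto simp: F0_def)
    have zero': "(\<lambda>_. 0) \<in> ?F" using zero by simp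
    have u: "cost_le ?F {U q} (2 * N)" if "q \<in> {..<Q}" for q
      using cost_le_dot_product[OF finite_lessThan[of N] _ _ zero', of "\<lambda>j. ent (q, j)" bas]
        ent that by (auto simp: U_def F2_def)
    have ja: "cost_le ?F {J i} (2 * card {j\<in>{..<N}. snd i \<in> S j})"
      if "i \<in> {..<Q} \<times> {..<P}" for i
    proof -
      obtain q p where i: "i = (q, p)" "q < Q"
        using \<open>i \<in> {..<Q} \<times> {..<P}\<close> by auto
      have "dbas (j, p) \<in> ?F" if "j < N" "p \<in> S j" for j
        using that by (auto simp: F2_def I2_def)
      then show ?thesis
        using cost_le_dot_product[of "{j\<in>{..<N}. p \<in> S j}" "\<lambda>j. ent (q, j)" ?F "\<lambda>j. dbas (j, p)"]
          ent i zero' by (auto simp: J_def)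
    qed
    \<comment> \<open>Double counting of the pairs of a basis function and a coordinate on which it depends:
      this is why the factor \<open>P\<close> of a full Jacobian does not appear.\<close>
    have "(\<Sum>p<P. card {j\<in>{..<N}. p \<in> S j}) = (\<Sum>j<N. card {p\<in>{..<P}. p \<in> S j})"
      using sum.swap_restrict[of "{..<P}" "{..<N}" "\<lambda>_ _. 1::nat" "\<lambda>p j. p \<in> S j"] by simp
    also have "\<dots> \<le> (\<Sum>j<N. n)"
    proof (rule sum_mono)
      fix j assume "j \<in> {..<N}"
      then have "j < N" by simp
      have "{p\<in>{..<P}. p \<in> S j} \<subseteq> S j" by blast
      then show "card {p\<in>{..<P}. p \<in> S j} \<le> n"
        using card_mono[OF S(2)[OF \<open>j < N\<close>]] S(3)[OF \<open>j < N\<close>] le_trans by blast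
    qed
    finally have "(\<Sum>p<P. card {j\<in>{..<N}. p \<in> S j}) \<le> N * n" by simp
    then have "Q * (2 * (\<Sum>p<P. card {j\<in>{..<N}. p \<in> S j})) \<le> Q * (2 * (N * n))"
      by (intro mult_le_mono) auto
    then have "(\<Sum>i\<in>{..<Q} \<times> {..<P}. 2 * card {j\<in>{..<N}. snd i \<in> S j}) \<le> 2 * Q * N * n"
      by (simp add: sum.cartesian_product' sum_distrib_left mult_ac)
    from cost_le_mono[OF cost_le_UN[OF _ ja] _ _ this, of "?F \<union> U ` {..<Q}" "J ` ({..<Q} \<times> {..<P})"]
    have "cost_le (?F \<union> U ` {..<Q}) (J ` ({..<Q} \<times> {..<P})) (2 * Q * N * n)"
      by force
    from cost_le_trans[OF cost_le_image[OF finite_lessThan u order_refl] this]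
    show ?thesis by (rule cost_le_mono) (auto simp: F3_def algebra_simps)
  qed

  have "cost_le F0 F3 (4 * n * (n + 1) * P + N * (n + 1) * n + 2 * Q * N * (n + 1))"
    using cost_le_then[OF cost_le_trans[OF cost1 cost2] cost3] by blast
  from cost_le_program[OF inputs this]
  obtain prog where prog: "provides prog F3" "arithmetic_program prog"
    "length prog \<le> 4 * n * (n + 1) * P + N * (n + 1) * n + 2 * Q * N * (n + 1)"
    by blast
  from prog(1) obtain rs where rs: "\<And>x. x \<in> D \<Longrightarrow> run (sol_env n \<phi> (fst x) (snd x)) prog = Some (rs x)"
    and F3: "\<And>f. f \<in> F3 \<Longrightarrow> \<exists>a. \<forall>x\<in>D. operand_value (sol_env n \<phi> (fst x) (snd x)) (rs x) a = Some (f x)"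
    unfolding provides_def by blast
  have "\<exists>a. \<forall>x\<in>D. q < Q \<longrightarrow> operand_value (sol_env n \<phi> (fst x) (snd x)) (rs x) a = Some (U q x)" for q
    using F3[of "U q"] by (auto simp: F3_def)
  then obtain outU where outU: "\<And>q x. x \<in> D \<Longrightarrow> q < Q \<Longrightarrow>
      operand_value (sol_env n \<phi> (fst x) (snd x)) (rs x) (outU q) = Some (U q x)"
    by metis
  have "\<exists>a. \<forall>x\<in>D. q < Q \<longrightarrow> p < P \<longrightarrow>
      operand_value (sol_env n \<phi> (fst x) (snd x)) (rs x) a = Some (J (q, p) x)" for q p
    using F3[of "J (q, p)"] by (cases "q < Q \<and> p < P") (auto simp: F3_def)
  then obtain outJ where outJ: "\<And>q p x. x \<in> D \<Longrightarrow> q < Q \<Longrightarrow> p < P \<Longrightarrow>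
      operand_value (sol_env n \<phi> (fst x) (snd x)) (rs x) (outJ q p) = Some (J (q, p) x)"
    by metis

  have inactive: "\<Lambda> $$ (j, p) = 0" if "p < P" "p \<notin> S j" for j p
    using that col by (simp add: S_def active_def)
  have U: "solution V \<phi> \<Lambda> \<theta> $ q = U q (V, \<theta>)" if V: "V \<in> carrier_mat Q N" and q: "q < Q" for V \<theta> q
  proof -
    have "(\<Prod>p<P. poly (\<phi> (\<Lambda> $$ (j, p))) (\<theta> $ p)) = bas j (V, \<theta>)" if "j < N" for j
      using prod_constant_outside[OF S(1)[OF that], of "\<lambda>p. poly (\<phi> (\<Lambda> $$ (j, p))) (\<theta> $ p)" c]
      by (simp add: bas_def const_def val_def par_def inactive phi0)
    then show ?thesis
      using solution_index[OF V[unfolded N_def] q] by (simp add: U_def ent_def col N_def)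
  qed
  have J: "jacobian (solution V \<phi> \<Lambda>) \<theta> $$ (q, p) = J (q, p) (V, \<theta>)"
    if V: "V \<in> carrier_mat Q N" and t: "\<theta> \<in> carrier_vec P" and q: "q < Q" and p: "p < P" for V \<theta> q p
  proof -
    let ?g = "\<lambda>j p'. if p' = p then poly (pderiv (\<phi> (\<Lambda> $$ (j, p)))) (\<theta> $ p)
       else poly (\<phi> (\<Lambda> $$ (j, p'))) (\<theta> $ p')"
    have act: "(\<Prod>p'<P. ?g j p') = dbas (j, p) (V, \<theta>)" if "j < N" "p \<in> S j" for j
    proof -
      have "(\<Prod>p'<P. ?g j p') = c ^ (P - card (S j)) * (\<Prod>p'\<in>S j. ?g j p')"
        by (rule prod_constant_outside[OF S(1)[OF that(1)]]) (use that inactive phi0 in auto)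
      also have "(\<Prod>p'\<in>S j. ?g j p') = (\<Prod>p'\<in>S j.
          (if p' = p then der (p', \<Lambda> $$ (j, p')) else val (p', \<Lambda> $$ (j, p'))) (V, \<theta>))"
        by (rule prod.cong) (auto simp: der_def val_def par_def)
      finally show ?thesis by (simp add: dbas_def const_def)
    qed
    have "(\<Prod>p'<P. ?g j p') = 0" if "p \<notin> S j" for j
      by (rule prod_zero) (use that p in \<open>auto simp: inactive phi0 intro!: bexI[of _ p]\<close>)
    then have "(\<Sum>j<N. V $$ (q, j) * (\<Prod>p'<P. ?g j p')) =
        (\<Sum>j\<in>{j\<in>{..<N}. p \<in> S j}. V $$ (q, j) * (\<Prod>p'<P. ?g j p'))"
      by (intro sum.mono_neutral_right) auto
    also have "\<dots> = J (q, p) (V, \<theta>)"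
      unfolding J_def prod.case by (rule sum.cong) (auto simp: ent_def act)
    finally show ?thesis
      using jacobian_index[OF V[unfolded N_def] t col q p] by (simp add: N_def)
  qed
  have "computes_solution_and_jacobian n P Q E \<phi> \<Lambda> prog outU outJ"
    unfolding computes_solution_and_jacobian_def
  proof (intro ballI)
    fix V :: "real mat" and \<theta> assume "V \<in> carrier_mat Q (dim_row \<Lambda>)" and t: "\<theta> \<in> param_domain E P"
    then have V: "V \<in> carrier_mat Q N" and x: "(V, \<theta>) \<in> D" by (auto simp: N_def D_def)
    have "\<theta> \<in> carrier_vec P" using t by (simp add: param_domain_def)
    then show "\<exists>rs. run (sol_env n \<phi> V \<theta>) prog = Some rs \<and>
          (\<forall>q<Q. operand_value (sol_env n \<phi> V \<theta>) rs (outU q) = Some (solution V \<phi> \<Lambda> \<theta> $ q)) \<and>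
          (\<forall>q<Q. \<forall>p<P. operand_value (sol_env n \<phi> V \<theta>) rs (outJ q p) =
             Some (jacobian (solution V \<phi> \<Lambda>) \<theta> $$ (q, p)))"
      using rs[OF x] outU[OF x] outJ[OF x] U[OF V] J[OF V] by auto
  qed
  then show ?thesis using prog(2,3) unfolding N_def by blast
qed

lemma solution_jacobian_cost:
  assumes "P \<ge> 1" "Q \<ge> 1" "n \<ge> 1"
  shows "solution_jacobian_cost_le n P Q
    (real (4 * n * (n + 1) + (n + 1) ^ n * (n + 1) * (n + 2)) * real P ^ n * real Q)"
  unfolding solution_jacobian_cost_le_def
proof (intro allI impI)
  fix E w \<phi> \<Lambda>
  assume poly: "orthonormal_polys E w n \<phi>" and matrix: "total_degree_matrix n P \<Lambda>"
  let ?N = "dim_row \<Lambda>"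
  obtain prog outU outJ where prog: "arithmetic_program prog"
    "length prog \<le> 4 * n * (n + 1) * P + ?N * (n + 1) * n + 2 * Q * ?N * (n + 1)"
    "computes_solution_and_jacobian n P Q E \<phi> \<Lambda> prog outU outJ"
    using exists_program_solution_jacobian[OF orthonormal_degree[OF poly] matrix] by blast
  have "n + P \<le> (n + 1) * P" using assms(1) by (cases P) auto
  then have "?N \<le> ((n + 1) * P) ^ n"
    using total_degree_rows(2)[OF matrix] power_mono le_trans by blast
  then have N: "?N \<le> (n + 1) ^ n * P ^ n" by (simp only: power_mult_distrib)
  have "P * 1 \<le> P ^ n * Q" using assms by (intro mult_le_mono self_le_power) auto
  then have A: "4 * n * (n + 1) * P \<le> 4 * n * (n + 1) * (P ^ n * Q)" by simp
  have "?N * (n + 1) * n + 2 * Q * ?N * (n + 1) = 1 * (?N * (n + 1) * n) + 2 * Q * ?N * (n + 1)"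
    by simp
  also have "\<dots> \<le> Q * (?N * (n + 1) * n) + 2 * Q * ?N * (n + 1)"
    by (intro add_right_mono mult_le_mono1 assms(2))
  also have "\<dots> = ?N * (Q * (n + 1) * (n + 2))" by (simp add: algebra_simps)
  also have "\<dots> \<le> ((n + 1) ^ n * P ^ n) * (Q * (n + 1) * (n + 2))"
    by (rule mult_le_mono1[OF N])
  finally have B: "?N * (n + 1) * n + 2 * Q * ?N * (n + 1) \<le>
      ((n + 1) ^ n * P ^ n) * (Q * (n + 1) * (n + 2))" .
  have regroup: "x * (y * Q) + (k * y) * (Q * l * m) = (x + k * l * m) * y * Q" for x y k l m :: nat
    by (simp add: algebra_simps)
  have "length prog \<le> 4 * n * (n + 1) * (P ^ n * Q) +
      ((n + 1) ^ n * P ^ n) * (Q * (n + 1) * (n + 2))"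
    using le_trans[OF prog(2)[unfolded add.assoc[of "4 * n * (n + 1) * P"]] add_mono[OF A B]] .
  then have "length prog \<le> (4 * n * (n + 1) + (n + 1) ^ n * (n + 1) * (n + 2)) * P ^ n * Q"
    unfolding regroup .
  then have "real (length prog) \<le>
      real ((4 * n * (n + 1) + (n + 1) ^ n * (n + 1) * (n + 2)) * P ^ n * Q)"
    by (rule of_nat_mono)
  then have "real (length prog) \<le>
      real (4 * n * (n + 1) + (n + 1) ^ n * (n + 1) * (n + 2)) * real P ^ n * real Q"
    unfolding of_nat_mult[of _ Q] of_nat_mult[of _ "P ^ n"] of_nat_power[of P n] .
  then show "\<exists>prog outU outJ. arithmetic_program prog \<and>
      real (length prog) \<le> real (4 * n * (n + 1) + (n + 1) ^ n * (n + 1) * (n + 2)) * real P ^ n * real Q \<and>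
      computes_solution_and_jacobian n P Q E \<phi> \<Lambda> prog outU outJ"
    using prog(1,3) by blast
qed

section \<open>Gram-Schmidt orthonormalization\<close>

definition dot :: "nat \<Rightarrow> (nat \<Rightarrow> real) \<Rightarrow> (nat \<Rightarrow> real) \<Rightarrow> real" where
  "dot m u v = (\<Sum>i<m. u i * v i)"

fun gram_schmidt_vec :: "nat \<Rightarrow> (nat \<Rightarrow> nat \<Rightarrow> real) \<Rightarrow> nat \<Rightarrow> nat \<Rightarrow> real" where
  "gram_schmidt_vec m a j =
     (let v = (\<lambda>i. a j i - (\<Sum>k<j. dot m (gram_schmidt_vec m a k) (a j) * gram_schmidt_vec m a k i))
      in (\<lambda>i. v i / sqrt (dot m v v)))"

declare gram_schmidt_vec.simps [simp del]

definition residual :: "nat \<Rightarrow> (nat \<Rightarrow> nat \<Rightarrow> real) \<Rightarrow> nat \<Rightarrow> nat \<Rightarrow> real" where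
  "residual m a j i =
     a j i - (\<Sum>k<j. dot m (gram_schmidt_vec m a k) (a j) * gram_schmidt_vec m a k i)"

definition residual_norm :: "nat \<Rightarrow> (nat \<Rightarrow> nat \<Rightarrow> real) \<Rightarrow> nat \<Rightarrow> real" where
  "residual_norm m a j = sqrt (dot m (residual m a j) (residual m a j))"

lemma gram_schmidt_vec_eq: "gram_schmidt_vec m a j i = residual m a j i / residual_norm m a j"
  unfolding residual_norm_def residual_def[abs_def]
  by (subst gram_schmidt_vec.simps) (simp add: Let_def)

lemma dot_commute: "dot m u v = dot m v u"
  by (simp add: dot_def mult.commute)

lemma dot_self_nonneg: "dot m v v \<ge> 0"
  by (simp add: dot_def sum_nonneg)

lemma dot_divide_right: "dot m u (\<lambda>i. v i / c) = dot m u v / c"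
  by (simp add: dot_def sum_divide_distrib)

lemma dot_divide_left: "dot m (\<lambda>i. v i / c) u = dot m v u / c"
  by (simp add: dot_def sum_divide_distrib)

lemma dot_diff_sum_right:
  "dot m u (\<lambda>i. v i - (\<Sum>k\<in>K. r k * w k i)) = dot m u v - (\<Sum>k\<in>K. r k * dot m u (w k))"
proof -
  have "(\<Sum>i<m. u i * (\<Sum>k\<in>K. r k * w k i)) = (\<Sum>k\<in>K. \<Sum>i<m. u i * (r k * w k i))"
    unfolding sum_distrib_left by (rule sum.swap)
  then show ?thesis
    by (simp add: dot_def right_diff_distrib sum_subtractf sum_distrib_left mult_ac)
qed

text \<open>
  A residual is a linear combination of the first \<open>j + 1\<close> columns in which column \<open>j\<close> has
  coefficient one, hence nonzero by linear independence. To know that this coefficient is one,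
  the induction has to carry along that each earlier vector involves no later columns.
\<close>

lemma gram_schmidt_step:
  assumes indep: "\<forall>u. (\<forall>i<m. (\<Sum>l<P. u l * a l i) = 0) \<longrightarrow> (\<forall>l<P. u l = (0::real))"
    and "j < P"
  shows "residual_norm m a j > 0 \<and>
    (\<forall>k\<le>j. dot m (gram_schmidt_vec m a k) (gram_schmidt_vec m a j) = (if k = j then 1 else 0)) \<and>
    (\<exists>u. (\<forall>l>j. u l = 0) \<and> (\<forall>i. gram_schmidt_vec m a j i = (\<Sum>l<P. u l * a l i)))"
  using \<open>j < P\<close>
proof (induction j rule: less_induct)
  case (less j)
  let ?q = "gram_schmidt_vec m a" and ?v = "residual m a j" and ?s = "residual_norm m a j"
  let ?r = "\<lambda>k. dot m (?q k) (a j)"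
  have IH: "\<forall>k'\<le>k. dot m (?q k') (?q k) = (if k' = k then 1 else 0)"
      "\<exists>u. (\<forall>l>k. u l = 0) \<and> (\<forall>i. ?q k i = (\<Sum>l<P. u l * a l i))" if "k < j" for k
    using less.IH[OF that] that less.prems by auto
  obtain u where u: "\<And>k l. k < j \<Longrightarrow> l > k \<Longrightarrow> u k l = 0"
      "\<And>k i. k < j \<Longrightarrow> ?q k i = (\<Sum>l<P. u k l * a l i)"
    using IH(2) by metis
  define w where "w = (\<lambda>l. (if l = j then 1 else 0) - (\<Sum>k<j. ?r k * u k l))"
  have w: "w j = 1" "\<And>l. l > j \<Longrightarrow> w l = 0" using u(1) by (auto simp: w_def)
  have v: "?v i = (\<Sum>l<P. w l * a l i)" for i
  proof -
    have "(\<Sum>k<j. ?r k * ?q k i) = (\<Sum>k<j. \<Sum>l<P. ?r k * u k l * a l i)"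
      by (simp add: u(2) sum_distrib_left mult.assoc)
    also have "\<dots> = (\<Sum>l<P. \<Sum>k<j. ?r k * u k l * a l i)" by (rule sum.swap)
    finally have "(\<Sum>k<j. ?r k * ?q k i) = (\<Sum>l<P. (\<Sum>k<j. ?r k * u k l) * a l i)"
      by (simp add: sum_distrib_right)
    moreover have "a j i = (\<Sum>l<P. (if l = j then 1 else 0) * a l i)"
      using less.prems by (simp add: if_distrib[of "\<lambda>c. c * _"] cong: if_cong)
    ultimately show ?thesis
      by (simp add: residual_def w_def left_diff_distrib sum_subtractf)
  qed
  have "dot m ?v ?v \<noteq> 0"
  proof
    assume "dot m ?v ?v = 0"
    then have "?v i = 0" if "i < m" for i
      using that by (simp add: dot_def sum_nonneg_eq_0_iff)
    then have "(\<Sum>l<P. w l * a l i) = 0" if "i < m" for i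
      using that by (simp flip: v)
    then have "\<forall>l<P. w l = 0" using indep by blast
    then show False using w(1) less.prems by simp
  qed
  then have norm: "?s > 0" and square: "?s * ?s = dot m ?v ?v"
    using dot_self_nonneg[of m ?v] by (auto simp: residual_norm_def)
  have q: "?q j = (\<lambda>i. ?v i / ?s)" by (rule ext) (rule gram_schmidt_vec_eq)
  have orth: "dot m (?q k) (?q j) = 0" if "k < j" for k
  proof -
    have pairs: "dot m (?q k) (?q k') = (if k' = k then 1 else 0)" if "k' < j" for k'
      using IH(1)[OF \<open>k < j\<close>] IH(1)[OF that] dot_commute[of m "?q k" "?q k'"]
      by (cases "k \<le> k'") auto
    have "dot m (?q k) ?v = ?r k - (\<Sum>k'<j. ?r k' * dot m (?q k) (?q k'))"
      unfolding residual_def[abs_def] by (rule dot_diff_sum_right)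
    also have "(\<Sum>k'<j. ?r k' * dot m (?q k) (?q k')) = ?r k"
      using that by (simp add: pairs if_distrib[of "\<lambda>c. _ * c"] cong: if_cong)
    finally show ?thesis by (simp add: q dot_divide_right)
  qed
  have "dot m (?q j) (?q j) = 1"
    using norm by (simp add: q dot_divide_left dot_divide_right flip: square)
  moreover have "?q j i = (\<Sum>l<P. (w l / ?s) * a l i)" for i
    by (simp add: q v sum_divide_distrib)
  ultimately have "\<exists>u. (\<forall>l>j. u l = 0) \<and> (\<forall>i. ?q j i = (\<Sum>l<P. u l * a l i))"
      and "\<forall>k\<le>j. dot m (?q k) (?q j) = (if k = j then 1 else 0)"
    using orth w(2) by (auto intro!: exI[of _ "\<lambda>l. w l / ?s"] simp del: times_divide_eq_left simp: le_less)
  then show ?case using norm by blast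
qed

definition columns :: "real mat \<Rightarrow> nat \<Rightarrow> nat \<Rightarrow> real" where
  "columns A j i = A $$ (i, j)"

lemma columns_independent:
  assumes "A \<in> carrier_mat Q P" "mat_kernel A = {0\<^sub>v P}"
  shows "\<forall>u. (\<forall>i<Q. (\<Sum>l<P. u l * columns A l i) = 0) \<longrightarrow> (\<forall>l<P. u l = 0)"
proof (intro allI impI)
  fix u l assume u: "\<forall>i<Q. (\<Sum>l<P. u l * columns A l i) = 0" and l: "l < P"
  have "A *\<^sub>v vec P u = 0\<^sub>v Q"
    using assms(1) u by (auto simp: scalar_prod_def atLeast0LessThan columns_def mult.commute)
  then have "vec P u \<in> mat_kernel A" using assms(1) by (simp add: mat_kernel)
  then have "vec P u = 0\<^sub>v P" using assms(2) by simp
  then show "u l = 0" using l by (metis index_vec index_zero_vec(1))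
qed

definition qr_Q :: "nat \<Rightarrow> nat \<Rightarrow> real mat \<Rightarrow> real mat" where
  "qr_Q P Q A = mat Q P (\<lambda>(i, j). gram_schmidt_vec Q (columns A) j i)"

definition qr_R :: "nat \<Rightarrow> nat \<Rightarrow> real mat \<Rightarrow> real mat" where
  "qr_R P Q A = mat P P (\<lambda>(k, j).
     if k < j then dot Q (gram_schmidt_vec Q (columns A) k) (columns A j)
     else if k = j then residual_norm Q (columns A) j else 0)"

lemma qr_correct:
  assumes A: "A \<in> carrier_mat Q P" and ker: "mat_kernel A = {0\<^sub>v P}"
  shows "(qr_Q P Q A)\<^sup>T * qr_Q P Q A = 1\<^sub>m P" "upper_triangular (qr_R P Q A)"
    "A = qr_Q P Q A * qr_R P Q A"
proof -
  let ?q = "gram_schmidt_vec Q (columns A)"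
  note step = gram_schmidt_step[OF columns_independent[OF A ker]]
  have orth: "dot Q (?q k) (?q j) = (if k = j then 1 else 0)" if "k < P" "j < P" for k j
    using step[OF that(1)] step[OF that(2)] dot_commute[of Q "?q k" "?q j"]
    by (cases "k \<le> j") auto
  show "(qr_Q P Q A)\<^sup>T * qr_Q P Q A = 1\<^sub>m P"
    by (rule eq_matI) (use orth in
      \<open>auto simp: qr_Q_def scalar_prod_def atLeast0LessThan dot_def\<close>)
  show "upper_triangular (qr_R P Q A)"
    by (auto simp: upper_triangular_def qr_R_def)
  have "A $$ (i, j) = (qr_Q P Q A * qr_R P Q A) $$ (i, j)" if i: "i < Q" and j: "j < P" for i j
  proof -
    let ?r = "\<lambda>k. if k < j then dot Q (?q k) (columns A j)
      else if k = j then residual_norm Q (columns A) j else 0"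
    have "(qr_Q P Q A * qr_R P Q A) $$ (i, j) = (\<Sum>k<P. ?q k i * ?r k)"
      using i j by (simp add: qr_Q_def qr_R_def scalar_prod_def atLeast0LessThan)
    also have "\<dots> = (\<Sum>k<Suc j. ?q k i * ?r k)"
      by (rule sum.mono_neutral_right) (use j in auto)
    also have "\<dots> = (\<Sum>k<j. dot Q (?q k) (columns A j) * ?q k i) + residual Q (columns A) j i"
      using step[OF j] by (simp add: gram_schmidt_vec_eq[of _ _ j] mult.commute)
    also have "\<dots> = A $$ (i, j)" by (simp add: residual_def columns_def)
    finally show ?thesis by simp
  qed
  then show "A = qr_Q P Q A * qr_R P Q A"
    using A by (intro eq_matI) (auto simp: qr_Q_def qr_R_def)
qed

text \<open>
  Also for \<open>P > Q\<close> the same program serves: it is then correct vacuously, because no instance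
  has linearly independent columns.
\<close>

lemma qr_cost:
  assumes "P \<ge> 1" "Q \<ge> 1"
  shows "qr_cost_le P Q (real (10 * P ^ 2 * Q))"
proof -
  define D where "D = {A \<in> carrier_mat Q P. mat_kernel A = {0\<^sub>v P :: real vec}}"
  interpret straight_line mat_env D True .
  define zero :: "real mat \<Rightarrow> real" where "zero = (\<lambda>_. 0)"
  define ent where "ent = (\<lambda>j i A. columns A j i)"
  define q where "q = (\<lambda>j i A. gram_schmidt_vec Q (columns A) j i)"
  define v where "v = (\<lambda>j i A. residual Q (columns A) j i)"
  define s where "s = (\<lambda>j A. residual_norm Q (columns A) j)"
  define r where "r = (\<lambda>j k A. dot Q (gram_schmidt_vec Q (columns A) k) (columns A j))"
  define F0 where "F0 = {ent j i |i j. i < Q \<and> j < P}"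
  define G where "G = (\<lambda>j. r j ` {..<j} \<union> {s j} \<union> q j ` {..<Q})"

  have s: "s j A > 0" if "A \<in> D" "j < P" for A j
    using gram_schmidt_step[OF columns_independent[of A Q P], of j] that
    by (auto simp: s_def D_def)
  have "provides [] F0"
  proof (rule provides_inputs)
    fix f assume "f \<in> F0"
    then obtain i j where "f = ent j i" "i < Q" "j < P" by (auto simp: F0_def)
    then show "\<exists>i. \<forall>x\<in>D. mat_env x i = Some (f x)"
      by (intro exI[of _ "(i, j)"]) (auto simp: ent_def columns_def D_def)
  qed
  moreover have "cost_le F0 ({zero} \<union> (\<Union>j<P. G j)) (1 + P * (9 * P * Q))"
  proof (rule cost_le_trans)
    \<comment> \<open>There are no constants among the inputs, so zero is obtained as a difference.\<close>
    have "ent 0 0 \<in> F0" using assms unfolding F0_def by force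
    from cost_le_diff[OF this this] show "cost_le F0 {zero} 1" by (simp add: zero_def)
    show "cost_le (F0 \<union> {zero}) (\<Union>j<P. G j) (P * (9 * P * Q))"
    proof (rule cost_le_sequence)
      fix j assume j: "j < P"
      define F where "F = F0 \<union> {zero} \<union> (\<Union>k<j. G k)"
      have ent: "ent j i \<in> F" if "i < Q" for i using that j by (auto simp: F_def F0_def)
      have q: "q k i \<in> F" if "i < Q" "k < j" for i k using that by (auto simp: F_def G_def)
      have zero: "(\<lambda>_. 0) \<in> F" by (simp add: F_def flip: zero_def)
      have 1: "cost_le F (r j ` {..<j}) (P * (2 * Q))"
      proof (rule cost_le_image)
        show "cost_le F {r j k} (2 * Q)" if "k \<in> {..<j}" for k
          using cost_le_dot_product[of "{..<Q}" "q k" F "ent j"] q ent zero that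
          by (simp add: r_def dot_def q_def ent_def)
      qed (use j in auto)
      have 2: "cost_le (F \<union> r j ` {..<j}) (v j ` {..<Q}) (Q * (2 * P + 1))"
      proof (rule cost_le_image)
        fix i assume i: "i \<in> {..<Q}"
        let ?d = "\<lambda>A. \<Sum>k<j. r j k A * q k i A"
        have "cost_le (F \<union> r j ` {..<j}) {?d} (2 * j)"
          using cost_le_dot_product[of "{..<j}" "r j" "F \<union> r j ` {..<j}" "\<lambda>k. q k i"] q zero i
          by simp
        moreover have "cost_le (F \<union> r j ` {..<j} \<union> {?d}) {v j i} 1"
          using cost_le_diff[of "ent j i" "F \<union> r j ` {..<j} \<union> {?d}" ?d] ent i
          by (simp add: v_def residual_def ent_def r_def q_def)
        ultimately show "cost_le (F \<union> r j ` {..<j}) {v j i} (2 * P + 1)"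
          by (rule cost_le_then) (use j in simp)
      qed auto
      let ?E = "r j ` {..<j} \<union> v j ` {..<Q}"
      have 3: "cost_le (F \<union> ?E) {s j} (2 * Q + 1)"
      proof -
        let ?n = "\<lambda>A. \<Sum>i<Q. v j i A * v j i A"
        have "cost_le (F \<union> ?E) {?n} (2 * Q)"
          using cost_le_dot_product[of "{..<Q}" "v j" "F \<union> ?E" "v j"] zero by simp
        moreover have "cost_le (F \<union> ?E \<union> {?n}) {s j} 1"
          using cost_le_sqrt[of ?n "F \<union> ?E \<union> {?n}"]
          by (simp add: s_def residual_norm_def dot_def v_def sum_nonneg)
        ultimately show ?thesis by (rule cost_le_then) simp
      qed
      have 4: "cost_le (F \<union> (?E \<union> {s j})) (q j ` {..<Q}) Q"
      proof (rule cost_le_image)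
        fix i assume "i \<in> {..<Q}"
        then show "cost_le (F \<union> (?E \<union> {s j})) {q j i} 1"
          using cost_le_divide[of "v j i" "F \<union> (?E \<union> {s j})" "s j"] s[OF _ j]
          by (force simp: q_def gram_schmidt_vec_eq v_def s_def)
      qed auto
      have "P * (2 * Q) + Q * (2 * P + 1) + (2 * Q + 1) + Q = 4 * (P * Q) + 4 * Q + 1"
        by (simp add: algebra_simps)
      also have "\<dots> \<le> 9 * P * Q"
        using mult_le_mono1[OF assms(1), of Q, unfolded mult_1] assms(2)
        unfolding mult.assoc by linarith
      finally have bound: "P * (2 * Q) + Q * (2 * P + 1) + (2 * Q + 1) + Q \<le> 9 * P * Q" .
      show "cost_le (F0 \<union> {zero} \<union> (\<Union>k<j. G k)) (G j) (9 * P * Q)"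
        unfolding F_def[symmetric]
        by (rule cost_le_mono[OF cost_le_trans[OF cost_le_trans[OF cost_le_trans[OF 1 2] 3] 4]])
          (use bound in \<open>auto simp: G_def\<close>)
    qed
  qed
  ultimately obtain prog where prog: "length prog \<le> 1 + P * (9 * P * Q)"
      "provides prog ({zero} \<union> (\<Union>j<P. G j))"
    using cost_le_program by blast
  from prog(2) obtain rs where rs: "\<And>A. A \<in> D \<Longrightarrow> run (mat_env A) prog = Some (rs A)"
    and out: "\<And>f. f \<in> {zero} \<union> (\<Union>j<P. G j) \<Longrightarrow>
      \<exists>a. \<forall>A\<in>D. operand_value (mat_env A) (rs A) a = Some (f A)"
    unfolding provides_def by blast
  have "\<exists>a. \<forall>A\<in>D. i < Q \<longrightarrow> j < P \<longrightarrow>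
      operand_value (mat_env A) (rs A) a = Some (qr_Q P Q A $$ (i, j))" for i j
  proof (cases "i < Q \<and> j < P")
    case True
    then have "q j i \<in> {zero} \<union> (\<Union>j<P. G j)" by (auto simp: G_def)
    from out[OF this] show ?thesis using True by (simp add: q_def qr_Q_def)
  qed auto
  then obtain outB where outB: "\<And>A i j. A \<in> D \<Longrightarrow> i < Q \<Longrightarrow> j < P \<Longrightarrow>
      operand_value (mat_env A) (rs A) (outB i j) = Some (qr_Q P Q A $$ (i, j))"
    by metis
  have "\<exists>a. \<forall>A\<in>D. i < P \<longrightarrow> j < P \<longrightarrow>
      operand_value (mat_env A) (rs A) a = Some (qr_R P Q A $$ (i, j))" for i j
  proof (cases "i < P \<and> j < P")
    case True
    let ?f = "if i < j then r j i else if i = j then s j else zero"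
    have "?f \<in> {zero} \<union> (\<Union>j<P. G j)" using True by (auto simp: G_def)
    then obtain a where "\<forall>A\<in>D. operand_value (mat_env A) (rs A) a = Some (?f A)"
      using out by blast
    moreover have "?f A = qr_R P Q A $$ (i, j)" for A
      using True by (auto simp: qr_R_def r_def s_def zero_def)
    ultimately show ?thesis by (intro exI[of _ a]) simp
  qed auto
  then obtain outR where outR: "\<And>A i j. A \<in> D \<Longrightarrow> i < P \<Longrightarrow> j < P \<Longrightarrow>
      operand_value (mat_env A) (rs A) (outR i j) = Some (qr_R P Q A $$ (i, j))"
    by metis
  have "computes_qr P Q prog outB outR"
    unfolding computes_qr_def
  proof (intro ballI impI)
    fix A :: "real mat" assume A: "A \<in> carrier_mat Q P" and ker: "mat_kernel A = {0\<^sub>v P}"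
    then have D: "A \<in> D" by (simp add: D_def)
    show "\<exists>rs. \<exists>B \<in> carrier_mat Q P. \<exists>R \<in> carrier_mat P P. run (mat_env A) prog = Some rs \<and>
           (\<forall>i<Q. \<forall>j<P. operand_value (mat_env A) rs (outB i j) = Some (B $$ (i, j))) \<and>
           (\<forall>i<P. \<forall>j<P. operand_value (mat_env A) rs (outR i j) = Some (R $$ (i, j))) \<and>
           B\<^sup>T * B = 1\<^sub>m P \<and> upper_triangular R \<and> A = B * R"
      by (intro exI[of _ "rs A"] bexI[of _ "qr_Q P Q A"] bexI[of _ "qr_R P Q A"] conjI
          rs[OF D] qr_correct[OF A ker]) (auto simp: outB[OF D] outR[OF D] qr_Q_def qr_R_def)
  qed
  moreover have "length prog \<le> 10 * P ^ 2 * Q"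
  proof -
    have "1 \<le> P ^ 2 * Q" using assms by simp
    moreover have "P * (9 * P * Q) = 9 * (P ^ 2 * Q)" by (simp add: power2_eq_square)
    ultimately show ?thesis using prog(1) unfolding mult.assoc by linarith
  qed
  ultimately show ?thesis unfolding qr_cost_le_def by (meson of_nat_mono)
qed

theorem mainTheorem1:
  fixes n :: nat
  assumes "n \<ge> 1"
  shows
    "(\<exists>C. \<forall>P\<ge>1. \<forall>Q\<ge>1. solution_jacobian_cost_le n P Q (C * real P ^ n * real Q)) \<and>
     (\<exists>C. \<forall>P\<ge>1. \<forall>Q\<ge>1.
        solution_jacobian_cost_le 2 P Q (C * real P ^ 2 * real Q) \<and>
        qr_cost_le P Q (C * real P ^ 2 * real Q))"
proof
  show "\<exists>C. \<forall>P\<ge>1. \<forall>Q\<ge>1. solution_jacobian_cost_le n P Q (C * real P ^ n * real Q)"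
    using solution_jacobian_cost[OF _ _ assms] by blast
  \<comment> \<open>For \<open>n = 2\<close> the constant of the first part is \<open>4 * 2 * 3 + 3 ^ 2 * 3 * 4 = 132\<close>,
    which exceeds the constant 10 of the QR decomposition.\<close>
  show "\<exists>C. \<forall>P\<ge>1. \<forall>Q\<ge>1. solution_jacobian_cost_le 2 P Q (C * real P ^ 2 * real Q) \<and>
        qr_cost_le P Q (C * real P ^ 2 * real Q)"
  proof (intro exI[of _ 132] allI impI conjI)
    fix P Q :: nat assume PQ: "P \<ge> 1" "Q \<ge> 1"
    show "solution_jacobian_cost_le 2 P Q (132 * real P ^ 2 * real Q)"
      using solution_jacobian_cost[OF PQ, of 2] by simp
    have "real (10 * P ^ 2 * Q) \<le> 132 * real P ^ 2 * real Q"
      by (simp add: mult_right_mono)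
    then show "qr_cost_le P Q (132 * real P ^ 2 * real Q)"
      using qr_cost[OF PQ] unfolding qr_cost_le_def by (meson order_trans)
  qed
qed

end
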